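(* Let $\mathcal{L}_1,\mathcal{L}_2\subseteq[0,1]^N$ be two loss spaces such that $\|\boldsymbol{l}\|_{\mathcal{A}_1}\le1$ for all $\boldsymbol{l}\in\mathcal{L}_1$ and $\|\boldsymbol{l}\|_{\mathcal{A}_2}\le1$ for all $\boldsymbol{l}\in\mathcal{L}_2$, where $\mathcal{A}_1,\mathcal{A}_2\subseteq\mathbb{R}^N$ are centrally symmetric, convex, compact sets. Suppose there are strictly convex, differentiable functions $R_1:\Omega_1\to\mathbb{R}$ and $R_2:\Omega_2\to\mathbb{R}$ ($\Omega_1,\Omega_2\supseteq\Delta_N$ convex) such that Online Mirror Descent with regularizers $R_1$ and $R_2$ gives the regret bounds $D_1\sqrt{2T/\alpha_1}$ and $D_2\sqrt{2T/\alpha_2}$ over the loss spaces $\mathcal{L}_1$ and $\mathcal{L}_2$, respectively, where for $i\in\{1,2\}$, $\alpha_i>0$ is the strong convexity parameter of $R_i$ over $\Delta_N$ with respect to $\|\cdot\|^*_{\mathcal{A}_i}$, and $D_1,D_2$ are such that for all $\mathbf{p}\in\Delta_N$, $$R_1(\mathbf{p})-R_1(\mathbf{p}_1')\le D_1^2,\quad \mathbf{p}_1':=\operatorname{argmin}_{\mathbf{q}\in\Delta_N}R_1(\mathbf{q}),\qquad R_2(\mathbf{p})-R_2(\mathbf{p}_2')\le D_2^2,\quad \mathbf{p}_2':=\operatorname{argmin}_{\mathbf{q}\in\Delta_N}R_2(\mathbf{q}).$$ Then, for loss vectors from the additive loss space $\mathcal{L}=\mathcal{L}_1+\mathcal{L}_2$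 (Minkowski sum), Online Mirror Descent with regularizer $R=R_1+R_2$ (on $\Omega=\Omega_1\cap\Omega_2$), initial prediction $\mathbf{p}_1=\operatorname{argmin}_{\mathbf{p}\in\Delta_N}(R_1(\mathbf{p})+R_2(\mathbf{p}))$ and learning rate $\eta^*=\sqrt{\frac{(D_1^2+D_2^2)\min(\alpha_1,\alpha_2)}{T}}$ satisfies $$\mathrm{Regret}_T\le2\sqrt{\frac{(D_1^2+D_2^2)\,T}{\min(\alpha_1,\alpha_2)}}.$$
   Context: Notation: $\Delta_N=\{\mathbf{x}\in[0,1]^N:\sum_i x_i=1\}$. For a convex, compact, centrally symmetric set $\mathcal{A}\subseteq\mathbb{R}^N$, the atomic norm is $\|\mathbf{x}\|_{\mathcal{A}}:=\inf\{t>0:\mathbf{x}\in t\mathcal{A}\}$ and its dual is $\|\mathbf{x}\|^*_{\mathcal{A}}:=\sup\{\mathbf{x}\cdot\mathbf{z}:\mathbf{z}\in\mathcal{A}\}$. A differentiable $f$ is $\alpha$-strongly convex over a convex set $S$ with respect to $\|\cdot\|$ if $f(\mathbf{x})-f(\mathbf{y})-\nabla f(\mathbf{y})\cdot(\mathbf{x}-\mathbf{y})\ge\frac{\alpha}{2}\|\mathbf{x}-\mathbf{y}\|^2$ for all $\mathbf{x},\mathbf{y}\in S$. Prediction with expert advice: in each round $t=1,\dots,T$ the learner plays $\mathbf{p}_t\in\Delta_N$ (depending on $\boldsymbol{l}_1,\dots,\boldsymbol{l}_{t-1}$), then the loss vector $\boldsymbol{l}_t\in\mathbb{R}^N$ is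 revealed and the learner suffers $\mathbf{p}_t\cdot\boldsymbol{l}_t$. The regret is $\mathrm{Regret}_T=\sum_{t=1}^T\mathbf{p}_t\cdot\boldsymbol{l}_t-\min_{i\in\{1,\dots,N\}}\sum_{t=1}^T l_t(i)$. A regret bound over a loss space means a bound valid for every sequence of loss vectors from that space. Online Mirror Descent (OMD) with learning rate $\eta>0$, convex set $\Omega\supseteq\Delta_N$ and strictly convex differentiable regularizer $R:\Omega\to\mathbb{R}$: start with $\mathbf{p}_1=\operatorname{argmin}_{\mathbf{p}\in\Delta_N}R(\mathbf{p})$; after observing $\boldsymbol{l}_t$, let $\tilde{\mathbf{p}}_{t+1}\in\Omega$ satisfy $\nabla R(\tilde{\mathbf{p}}_{t+1})=\nabla R(\mathbf{p}_t)-\eta\boldsymbol{l}_t$ (it is assumed that such a point of $\Omega$ exists), and set $\mathbf{p}_{t+1}=\operatorname{argmin}_{\mathbf{p}\in\Delta_N}B_R(\mathbf{p},\tilde{\mathbf{p}}_{t+1})$, where $B_R(\mathbf{u},\mathbf{v})=R(\mathbf{u})-R(\mathbf{v})-(\mathbf{u}-\mathbf{v})\cdot\nabla R(\mathbf{v})$. *)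

theory Defs
  imports "HOL-Analysis.Analysis"
begin

definition prob_simplex :: "(real ^ 'n) set" where
  "prob_simplex = {p. (\<forall>i. 0 \<le> p $ i \<and> p $ i \<le> 1) \<and> (\<Sum>i\<in>UNIV. p $ i) = 1}"

definition centrally_symmetric :: "(real ^ 'n) set \<Rightarrow> bool" where
  "centrally_symmetric A \<longleftrightarrow> (\<forall>x\<in>A. - x \<in> A)"

(* Extended-real valued: a point in no dilate of A has atomic norm \<infinity>,
   whereas the infimum of the empty set of reals is unspecified. *)
definition atomic_norm :: "(real ^ 'n) set \<Rightarrow> real ^ 'n \<Rightarrow> ereal" where
  "atomic_norm A x = (INF t \<in> {t::real. 0 < t \<and> x \<in> (\<lambda>z. t *\<^sub>R z) ` A}. ereal t)"

(* Real valued: the supremum is finite for nonempty compact A. *)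
definition dual_atomic_norm :: "(real ^ 'n) set \<Rightarrow> real ^ 'n \<Rightarrow> real" where
  "dual_atomic_norm A x = (SUP z \<in> A. x \<bullet> z)"

definition strictly_convex_on :: "(real ^ 'n) set \<Rightarrow> (real ^ 'n \<Rightarrow> real) \<Rightarrow> bool" where
  "strictly_convex_on S f \<longleftrightarrow>
     (\<forall>x\<in>S. \<forall>y\<in>S. \<forall>u. x \<noteq> y \<and> 0 < u \<and> u < 1 \<longrightarrow>
        f ((1 - u) *\<^sub>R x + u *\<^sub>R y) < (1 - u) * f x + u * f y)"

(* g is a gradient of f on S. Only the values of f on S matter. On a convex S with
   nonempty interior g is determined on S; otherwise only up to vectors orthogonal
   to the affine hull of S, so the gradient is carried as an explicit argument. *)
definition has_gradient_on ::
  "(real ^ 'n \<Rightarrow> real) \<Rightarrow> (real ^ 'n \<Rightarrow> real ^ 'n) \<Rightarrow> (real ^ 'n) set \<Rightarrow> bool" where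
  "has_gradient_on f g S \<longleftrightarrow>
     (\<forall>x\<in>S. (f has_derivative (\<lambda>h. g x \<bullet> h)) (at x within S))"

(* To be used with g a gradient of f (on a set that may be larger than S). *)
definition strongly_convex_on ::
  "(real ^ 'n) set \<Rightarrow> (real ^ 'n \<Rightarrow> real) \<Rightarrow> real \<Rightarrow>
   (real ^ 'n \<Rightarrow> real) \<Rightarrow> (real ^ 'n \<Rightarrow> real ^ 'n) \<Rightarrow> bool" where
  "strongly_convex_on S nrm \<alpha> f g \<longleftrightarrow>
     (\<forall>x\<in>S. \<forall>y\<in>S. f x - f y - g y \<bullet> (x - y) \<ge> \<alpha> / 2 * (nrm (x - y))\<^sup>2)"

definition bregman ::
  "(real ^ 'n \<Rightarrow> real) \<Rightarrow> (real ^ 'n \<Rightarrow> real ^ 'n) \<Rightarrow> real ^ 'n \<Rightarrow> real ^ 'n \<Rightarrow> real" where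
  "bregman R g u v = R u - R v - (u - v) \<bullet> g v"

(* p 1, ..., p T are predictions of Online Mirror Descent against the losses
   l 1, ..., l T. The existence of the unprojected point w in \<Omega> is part of being a run;
   it is required only for the updates that produce p 2, ..., p T. *)
definition omd_run ::
  "(real ^ 'n) set \<Rightarrow> (real ^ 'n \<Rightarrow> real) \<Rightarrow> (real ^ 'n \<Rightarrow> real ^ 'n) \<Rightarrow> real \<Rightarrow> nat \<Rightarrow>
   (nat \<Rightarrow> real ^ 'n) \<Rightarrow> (nat \<Rightarrow> real ^ 'n) \<Rightarrow> bool" where
  "omd_run \<Omega> R g \<eta> T l p \<longleftrightarrow>
     is_arg_min R (\<lambda>q. q \<in> prob_simplex) (p 1) \<and>
     (\<forall>t\<in>{1..<T}. \<exists>w\<in>\<Omega>.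
        g w = g (p t) - \<eta> *\<^sub>R l t \<and>
        is_arg_min (\<lambda>q. bregman R g q w) (\<lambda>q. q \<in> prob_simplex) (p (Suc t)))"

definition regret :: "nat \<Rightarrow> (nat \<Rightarrow> real ^ 'n) \<Rightarrow> (nat \<Rightarrow> real ^ 'n) \<Rightarrow> real" where
  "regret T l p = (\<Sum>t=1..T. p t \<bullet> l t) - (MIN i. \<Sum>t=1..T. l t $ i)"

definition omd_regret_bound ::
  "(real ^ 'n) set \<Rightarrow> (real ^ 'n \<Rightarrow> real) \<Rightarrow> (real ^ 'n \<Rightarrow> real ^ 'n) \<Rightarrow> real \<Rightarrow> nat \<Rightarrow>
   (real ^ 'n) set \<Rightarrow> real \<Rightarrow> bool" where
  "omd_regret_bound \<Omega> R g \<eta> T L b \<longleftrightarrow>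
     (\<forall>l p. (\<forall>t\<in>{1..T}. l t \<in> L) \<and> omd_run \<Omega> R g \<eta> T l p \<longrightarrow> regret T l p \<le> b)"

end

theory Submission
  imports Defs
begin

text \<open>
  Over the simplex the update is the proximal step
  \<open>argmin\<^sub>q B\<^sub>R(q, p\<^sub>t) + \<eta> q \<bullet> l\<^sub>t\<close>, so its optimality condition and the three-point
  identity bound \<open>\<eta> l\<^sub>t \<bullet> (p\<^sub>t - q)\<close> by a telescoping difference of Bregman divergences
  plus \<open>\<eta> l\<^sub>t \<bullet> (p\<^sub>t - p\<^sub>t\<^sub>+\<^sub>1) - B\<^sub>R(p\<^sub>t\<^sub>+\<^sub>1, p\<^sub>t)\<close>. Splitting \<open>l\<^sub>t\<close> into its two summands
  and \<open>B\<^sub>R\<close> into \<open>B\<^bsub>R1\<^esub> + B\<^bsub>R2\<^esub>\<close>, each pair contributes at most \<open>\<eta>\<^sup>2 / (2 \<alpha>\<^sub>i)\<close>, by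
  duality of the norms and strong convexity.
\<close>

section \<open>The probability simplex, and gradients relative to a convex set\<close>

lemma convex_prob_simplex: "convex (prob_simplex :: (real ^ 'n) set)"
proof (rule convexI)
  fix x y :: "real ^ 'n" and u v :: real
  assume x: "x \<in> prob_simplex" and y: "y \<in> prob_simplex"
    and uv: "0 \<le> u" "0 \<le> v" "u + v = 1"
  have "u * x $ i + v * y $ i \<le> 1" for i
    using x y uv by (intro convex_bound_le) (auto simp: prob_simplex_def)
  moreover have "(\<Sum>i\<in>UNIV. u * x $ i + v * y $ i) = 1"
    using x y uv by (simp add: prob_simplex_def sum.distrib flip: sum_distrib_left)
  ultimately show "u *\<^sub>R x + v *\<^sub>R y \<in> prob_simplex"
    using x y uv by (auto simp: prob_simplex_def)
qed

lemma axis_in_prob_simplex: "axis i 1 \<in> (prob_simplex :: (real ^ 'n) set)"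
  by (auto simp: prob_simplex_def axis_def)

lemma has_gradient_on_subset:
  "has_gradient_on f g S \<Longrightarrow> U \<subseteq> S \<Longrightarrow> has_gradient_on f g U"
  unfolding has_gradient_on_def by (blast intro: has_derivative_subset)

lemma has_gradient_on_add:
  "has_gradient_on f1 g1 S \<Longrightarrow> has_gradient_on f2 g2 S \<Longrightarrow>
   has_gradient_on (\<lambda>x. f1 x + f2 x) (\<lambda>x. g1 x + g2 x) S"
  unfolding has_gradient_on_def inner_add_left by (blast intro: has_derivative_add)

text \<open>Chain rule along the segment from \<open>x\<close> to \<open>y\<close>, which convexity
  keeps inside \<open>S\<close>. The derivative is taken within \<open>S\<close>, so only the
  one-sided limit is available.\<close>

lemma directional_derivative_within_convex:
  fixes f :: "'a::real_inner \<Rightarrow> real"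
  assumes S: "convex S" "x \<in> S" "y \<in> S"
    and f: "(f has_derivative (\<lambda>h. d \<bullet> h)) (at x within S)"
  shows "((\<lambda>t. (f (x + t *\<^sub>R (y - x)) - f x) / t) \<longlongrightarrow> d \<bullet> (y - x)) (at_right 0)"
proof -
  define L where "L = (\<lambda>t::real. x + t *\<^sub>R (y - x))"
  have seg: "L ` {0..1} \<subseteq> S"
  proof
    fix z assume "z \<in> L ` {0..1}"
    then obtain t where t: "0 \<le> t" "t \<le> 1" "z = L t" by auto
    have "(1 - t) *\<^sub>R x + t *\<^sub>R y \<in> S"
      using t by (intro convexD[OF S]) auto
    then show "z \<in> S" by (simp add: t(3) L_def algebra_simps)
  qed
  have "(L has_derivative (\<lambda>t. t *\<^sub>R (y - x))) (at 0 within {0..1})"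
    unfolding L_def by (auto intro!: derivative_eq_intros)
  moreover have "(f has_derivative (\<lambda>h. d \<bullet> h)) (at (L 0) within L ` {0..1})"
    using has_derivative_subset[OF f seg] by (simp add: L_def)
  ultimately have "((\<lambda>t. f (L t)) has_derivative (\<lambda>t. d \<bullet> (t *\<^sub>R (y - x)))) (at 0 within {0..1})"
    by (rule has_derivative_in_compose)
  then have "((\<lambda>t. f (L t)) has_field_derivative d \<bullet> (y - x)) (at 0 within {0..1})"
    by (simp add: has_field_derivative_def mult.commute[of _ "d \<bullet> (y - x)"])
  then have "((\<lambda>t. (f (L t) - f x) / t) \<longlongrightarrow> d \<bullet> (y - x)) (at 0 within {0..1})"
    by (simp add: has_field_derivative_iff L_def)
  then show ?thesis
    by (simp add: L_def at_within_Icc_at_right)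
qed

text \<open>Both sides are the limit of the same difference quotients. Gradients relative to a set
  with empty interior, such as the simplex, may differ, but not along directions that point into the
  set.\<close>

lemma gradient_inner_unique:
  assumes "convex S" "x \<in> S" "y \<in> S" "has_gradient_on f g S" "has_gradient_on f h S"
  shows "g x \<bullet> (y - x) = h x \<bullet> (y - x)"
proof -
  have "((\<lambda>t. (f (x + t *\<^sub>R (y - x)) - f x) / t) \<longlongrightarrow> g x \<bullet> (y - x)) (at_right 0)"
    and "((\<lambda>t. (f (x + t *\<^sub>R (y - x)) - f x) / t) \<longlongrightarrow> h x \<bullet> (y - x)) (at_right 0)"
    using assms by (auto simp: has_gradient_on_def intro!: directional_derivative_within_convex)
  then show ?thesis
    by (rule tendsto_unique[rotated]) simp
qed

text \<open>By minimality the difference quotients from \<open>x\<close> towards \<open>y\<close>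
  are nonnegative, and so is their limit.\<close>

lemma is_arg_min_first_order:
  fixes f :: "'a::real_inner \<Rightarrow> real"
  assumes S: "convex S" "y \<in> S" and x: "is_arg_min f (\<lambda>q. q \<in> S) x"
    and f: "(f has_derivative (\<lambda>h. d \<bullet> h)) (at x within S)"
  shows "0 \<le> d \<bullet> (y - x)"
proof -
  have xS: "x \<in> S" and le: "\<And>z. z \<in> S \<Longrightarrow> f x \<le> f z"
    using x by (auto simp: is_arg_min_def not_less)
  have "\<forall>\<^sub>F t in at_right (0::real). t \<in> {0<..<1}"
    by (rule eventually_at_right_real) simp
  then have "\<forall>\<^sub>F t in at_right 0. 0 \<le> (f (x + t *\<^sub>R (y - x)) - f x) / t"
  proof eventually_elim
    case (elim t)
    have "(1 - t) *\<^sub>R x + t *\<^sub>R y \<in> S"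
      using elim xS S by (intro convexD) auto
    then have "f x \<le> f (x + t *\<^sub>R (y - x))"
      by (intro le) (simp add: algebra_simps)
    then show ?case using elim by simp
  qed
  then show ?thesis
    by (intro tendsto_lowerbound[OF directional_derivative_within_convex[OF S(1) xS S(2) f]]) auto
qed

section \<open>Bregman divergences, duality of norms and strong convexity\<close>

lemma bregman_three_point:
  "(g v - g u) \<bullet> (q - v) = bregman R g q u - bregman R g q v - bregman R g v u"
  by (simp add: bregman_def inner_diff_left inner_diff_right inner_commute)

text \<open>Write \<open>l\<close> as a multiple of a point of \<open>A\<close> and bound the inner
  product by the supremum; symmetry of \<open>A\<close> supplies the absolute value.\<close>

lemma abs_inner_le_dual_atomic_norm:
  assumes sym: "centrally_symmetric A" and A: "compact A" and l: "atomic_norm A l \<le> 1"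
  shows "\<bar>l \<bullet> x\<bar> \<le> dual_atomic_norm A x"
proof -
  have bdd: "bdd_above ((\<lambda>z. x \<bullet> z) ` A)"
    by (intro compact_imp_bounded[THEN bounded_imp_bdd_above] compact_continuous_image
        continuous_intros A)
  have z: "\<bar>x \<bullet> z\<bar> \<le> dual_atomic_norm A x" if "z \<in> A" for z
  proof -
    have "- z \<in> A" using sym that by (simp add: centrally_symmetric_def)
    from cSUP_upper[OF that bdd] cSUP_upper[OF this bdd] show ?thesis
      by (auto simp: dual_atomic_norm_def)
  qed
  \<comment> \<open>Instead of showing that the infimum is attained, \<open>l\<close> is placed in a
    dilate of \<open>A\<close> by some \<open>t < 1 + e\<close>; the slack vanishes as
    \<open>e\<close> tends to 0.\<close>
  have *: "\<bar>l \<bullet> x\<bar> \<le> (1 + e) * dual_atomic_norm A x" if "0 < e" for e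
  proof -
    have "atomic_norm A l < ereal (1 + e)"
      using l that by (auto intro: le_less_trans simp: one_ereal_def)
    then obtain t z where t: "0 < t" "t < 1 + e" "z \<in> A" "l = t *\<^sub>R z"
      by (auto simp: atomic_norm_def INF_less_iff)
    have "\<bar>l \<bullet> x\<bar> = t * \<bar>x \<bullet> z\<bar>"
      using t by (simp add: abs_mult inner_commute)
    also have "\<dots> \<le> (1 + e) * dual_atomic_norm A x"
      using t z by (intro mult_mono) auto
    finally show ?thesis .
  qed
  have "((\<lambda>e. (1 + e) * dual_atomic_norm A x) \<longlongrightarrow> (1 + 0) * dual_atomic_norm A x) (at_right 0)"
    by (intro tendsto_intros)
  then have "\<bar>l \<bullet> x\<bar> \<le> (1 + 0) * dual_atomic_norm A x"
    by (rule tendsto_lowerbound) (auto intro!: * eventually_at_rightI[of 0 1])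
  then show ?thesis by simp
qed

text \<open>Completing the square; the right-hand side is the maximum over \<open>n\<close>, reached
  at \<open>n = \<eta> / a\<close>.\<close>

lemma linear_minus_quadratic_le:
  fixes a n \<eta> :: real
  assumes "0 < a"
  shows "\<eta> * n - a / 2 * n\<^sup>2 \<le> \<eta>\<^sup>2 / (2 * a)"
proof -
  have "\<eta>\<^sup>2 / (2 * a) - (\<eta> * n - a / 2 * n\<^sup>2) = (\<eta> - a * n)\<^sup>2 / (2 * a)"
    using assms by (simp add: field_simps power2_eq_square)
  then show ?thesis
    using assms by (smt (verit) divide_nonneg_pos zero_le_power2)
qed

text \<open>Duality bounds the linear term by \<open>\<eta>\<close> times the dual norm of
  \<open>y - x\<close>, while strong convexity puts \<open>a / 2\<close> times its square into the
  divergence. Only the maximum of their difference remains.\<close>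

lemma strongly_convex_on_inner_le:
  assumes A: "centrally_symmetric A" "compact A" "atomic_norm A l \<le> 1"
    and sc: "strongly_convex_on S (dual_atomic_norm A) a R g" "0 < a"
    and xy: "x \<in> S" "y \<in> S" and \<eta>: "0 \<le> \<eta>"
  shows "\<eta> * (l \<bullet> (x - y)) \<le> bregman R g y x + \<eta>\<^sup>2 / (2 * a)"
proof -
  let ?n = "dual_atomic_norm A (y - x)"
  have "l \<bullet> (x - y) = - (l \<bullet> (y - x))"
    by (simp add: inner_diff_right)
  then have "l \<bullet> (x - y) \<le> ?n"
    using abs_inner_le_dual_atomic_norm[OF A, of "y - x"] by linarith
  then have "\<eta> * (l \<bullet> (x - y)) \<le> \<eta> * ?n"
    using \<eta> by (rule mult_left_mono)
  moreover have "a / 2 * ?n\<^sup>2 \<le> bregman R g y x"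
    using sc(1) xy by (simp add: strongly_convex_on_def bregman_def inner_commute)
  ultimately show ?thesis
    using linear_minus_quadratic_le[OF sc(2), of \<eta> ?n] by linarith
qed

section \<open>Regret analysis of a single run of mirror descent\<close>

lemma omd_step:
  assumes R: "has_gradient_on R g prob_simplex"
    and q: "q \<in> prob_simplex"
    and w: "g w = g u - \<eta> *\<^sub>R l"
    and v: "is_arg_min (\<lambda>q. bregman R g q w) (\<lambda>q. q \<in> prob_simplex) v"
  shows "\<eta> * (l \<bullet> (v - q)) \<le> bregman R g q u - bregman R g q v - bregman R g v u"
proof -
  have "v \<in> prob_simplex" using v by (simp add: is_arg_min_def)
  then have "(R has_derivative (\<lambda>h. g v \<bullet> h)) (at v within prob_simplex)"
    using R by (simp add: has_gradient_on_def)
  \<comment> \<open>In its first argument the divergence has gradient \<open>g v - g w\<close> at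
    \<open>v\<close>. So \<open>w\<close> matters only through \<open>g w\<close>, which the update
    equation expresses by \<open>g u\<close> and \<open>l\<close>.\<close>
  then have "((\<lambda>q. bregman R g q w) has_derivative (\<lambda>h. (g v - g w) \<bullet> h))
      (at v within prob_simplex)"
    unfolding bregman_def
    by (auto intro!: derivative_eq_intros simp: inner_diff_left inner_diff_right inner_commute)
  then have "0 \<le> (g v - g w) \<bullet> (q - v)"
    by (rule is_arg_min_first_order[OF convex_prob_simplex q v])
  also have "(g v - g w) \<bullet> (q - v) = (g v - g u) \<bullet> (q - v) - \<eta> * (l \<bullet> (v - q))"
    by (simp add: w inner_diff_left inner_diff_right inner_add_left algebra_simps)
  finally show ?thesis
    by (simp add: bregman_three_point[of g v u q R])
qed

text \<open>In the last round, where no further prediction is made, the comparator \<open>q\<close> itself takes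
  the place of \<open>p\<^sub>T\<^sub>+\<^sub>1\<close>.\<close>

lemma omd_run_inner_sum_le:
  assumes T: "1 \<le> T" and R: "has_gradient_on R g prob_simplex"
    and run: "omd_run \<Omega> R g \<eta> T l p" and q: "q \<in> prob_simplex"
    and step: "\<And>t x y. t \<in> {1..T} \<Longrightarrow> x \<in> prob_simplex \<Longrightarrow> y \<in> prob_simplex \<Longrightarrow>
      \<eta> * (l t \<bullet> (x - y)) \<le> bregman R g y x + c"
  shows "\<eta> * (\<Sum>t=1..T. l t \<bullet> (p t - q)) \<le> R q - R (p 1) + real T * c"
proof -
  have p1: "is_arg_min R (\<lambda>q. q \<in> prob_simplex) (p 1)"
    and upd: "\<And>t. t \<in> {1..<T} \<Longrightarrow> \<exists>w\<in>\<Omega>. g w = g (p t) - \<eta> *\<^sub>R l t \<and>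
        is_arg_min (\<lambda>q. bregman R g q w) (\<lambda>q. q \<in> prob_simplex) (p (Suc t))"
    using run by (auto simp: omd_run_def)
  have p: "p t \<in> prob_simplex" if "t \<in> {1..T}" for t
  proof (cases "t = 1")
    case True
    then show ?thesis using p1 by (simp add: is_arg_min_def)
  next
    case False
    then have "t - 1 \<in> {1..<T}" "Suc (t - 1) = t" using that by auto
    then show ?thesis using upd[of "t - 1"] by (auto simp: is_arg_min_def)
  qed
  \<comment> \<open>Telescoping over the first \<open>m - 1\<close> rounds. Each costs an extra
    \<open>c\<close>, the price of having played \<open>p t\<close> where \<open>omd_step\<close>
    controls \<open>p (Suc t)\<close>.\<close>
  have partial: "\<eta> * (\<Sum>t=1..<m. l t \<bullet> (p t - q))
      \<le> bregman R g q (p 1) - bregman R g q (p m) + real (m - 1) * c"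
    if "1 \<le> m" "m \<le> T" for m
    using that
  proof (induction m rule: dec_induct)
    case base
    then show ?case by simp
  next
    case (step m)
    then have m: "m \<in> {1..<T}" by simp
    obtain w where "g w = g (p m) - \<eta> *\<^sub>R l m"
      "is_arg_min (\<lambda>q. bregman R g q w) (\<lambda>q. q \<in> prob_simplex) (p (Suc m))"
      using upd[OF m] by blast
    then have "\<eta> * (l m \<bullet> (p (Suc m) - q)) \<le>
        bregman R g q (p m) - bregman R g q (p (Suc m)) - bregman R g (p (Suc m)) (p m)"
      by (rule omd_step[OF R q])
    moreover have "\<eta> * (l m \<bullet> (p m - p (Suc m))) \<le> bregman R g (p (Suc m)) (p m) + c"
      using m p assms(5) by simp
    moreover have "\<eta> * (l m \<bullet> (p m - q)) =
        \<eta> * (l m \<bullet> (p m - p (Suc m))) + \<eta> * (l m \<bullet> (p (Suc m) - q))"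
      by (simp add: inner_diff_right algebra_simps)
    moreover have "real m * c = real (m - 1) * c + c"
      using step by (simp add: of_nat_diff algebra_simps)
    ultimately show ?case
      using step by (simp add: distrib_left)
  qed
  have "\<eta> * (l T \<bullet> (p T - q)) \<le> bregman R g q (p T) + c"
    using T p q step by simp
  moreover have "(\<Sum>t=1..T. l t \<bullet> (p t - q)) = (\<Sum>t=1..<T. l t \<bullet> (p t - q)) + l T \<bullet> (p T - q)"
    using T by (simp add: sum.last_plus)
  moreover have "real T * c = real (T - 1) * c + c"
    using T by (simp add: of_nat_diff algebra_simps)
  ultimately have "\<eta> * (\<Sum>t=1..T. l t \<bullet> (p t - q)) \<le> bregman R g q (p 1) + real T * c"
    using partial[OF T order_refl] by (simp add: distrib_left)
  \<comment> \<open>Since \<open>p 1\<close> minimises \<open>R\<close>, the linear term of the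
    divergence from \<open>p 1\<close> has the right sign to be dropped, which leaves
    \<open>R q - R (p 1)\<close>.\<close>
  moreover have "0 \<le> g (p 1) \<bullet> (q - p 1)"
    using R p1 by (intro is_arg_min_first_order[OF convex_prob_simplex q p1])
      (auto simp: has_gradient_on_def is_arg_min_def)
  ultimately show ?thesis
    by (simp add: bregman_def inner_commute)
qed

text \<open>A best expert exists because the index type is finite, and the corresponding vertex
  \<open>axis i 1\<close>, taken as comparator, gives exactly the regret.\<close>

lemma regret_le_if_inner_sum_le:
  fixes l p :: "nat \<Rightarrow> real ^ 'n"
  assumes "\<And>q. q \<in> prob_simplex \<Longrightarrow> (\<Sum>t=1..T. l t \<bullet> (p t - q)) \<le> b"
  shows "regret T l p \<le> b"
proof -
  have "(MIN i. \<Sum>t=1..T. l t $ i) \<in> range (\<lambda>i. \<Sum>t=1..T. l t $ i)"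
    by (rule Min_in) auto
  then obtain i where "(MIN i. \<Sum>t=1..T. l t $ i) = (\<Sum>t=1..T. l t $ i)"
    by blast
  then have "regret T l p = (\<Sum>t=1..T. l t \<bullet> (p t - axis i 1))"
    by (simp add: regret_def inner_diff_right inner_axis sum_subtractf inner_commute)
  then show ?thesis
    using assms[OF axis_in_prob_simplex] by simp
qed

text \<open>The midpoint of two distinct points of \<open>S\<close> would have a value strictly
  below \<open>c\<close>.\<close>

lemma strictly_convex_on_constant_imp_eq:
  assumes "strictly_convex_on \<Omega> f" "S \<subseteq> \<Omega>" "convex S"
    and le: "\<And>z. z \<in> S \<Longrightarrow> f z = c"
    and xy: "x \<in> S" "y \<in> S"
  shows "x = y"
proof (rule ccontr)
  assume "x \<noteq> y"
  then have "f ((1 - 1/2) *\<^sub>R x + (1/2) *\<^sub>R y) < (1 - 1/2) * f x + 1/2 * f y"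
    using assms(1)[unfolded strictly_convex_on_def, rule_format, of x y "1/2"] xy assms(2)
    by auto
  moreover have "(1 - 1/2) *\<^sub>R x + (1/2) *\<^sub>R y \<in> S"
    using assms(3) xy by (intro convexD) auto
  ultimately show False
    using le xy by auto
qed

section \<open>Additive loss spaces and the sum of two regularizers\<close>

theorem corollary6:
  fixes L1 L2 A1 A2 \<Omega>1 \<Omega>2 :: "(real ^ 'n) set"
    and R1 R2 :: "real ^ 'n \<Rightarrow> real"
    and g1 g2 g :: "real ^ 'n \<Rightarrow> real ^ 'n"
    and \<alpha>1 \<alpha>2 D1 D2 :: real
    and q1 q2 :: "real ^ 'n"
    and T :: nat
  assumes "1 \<le> T"
    and "L1 \<subseteq> {l. \<forall>i. 0 \<le> l $ i \<and> l $ i \<le> 1}"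
    and "L2 \<subseteq> {l. \<forall>i. 0 \<le> l $ i \<and> l $ i \<le> 1}"
    and "centrally_symmetric A1" "convex A1" "compact A1"
    and "centrally_symmetric A2" "convex A2" "compact A2"
    and "\<forall>l\<in>L1. atomic_norm A1 l \<le> 1"
    and "\<forall>l\<in>L2. atomic_norm A2 l \<le> 1"
    and "convex \<Omega>1" "prob_simplex \<subseteq> \<Omega>1"
    and "convex \<Omega>2" "prob_simplex \<subseteq> \<Omega>2"
    and "strictly_convex_on \<Omega>1 R1" "has_gradient_on R1 g1 \<Omega>1"
    and "strictly_convex_on \<Omega>2 R2" "has_gradient_on R2 g2 \<Omega>2"
    and "0 < \<alpha>1" "strongly_convex_on prob_simplex (dual_atomic_norm A1) \<alpha>1 R1 g1"
    and "0 < \<alpha>2" "strongly_convex_on prob_simplex (dual_atomic_norm A2) \<alpha>2 R2 g2"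
    and "is_arg_min R1 (\<lambda>q. q \<in> prob_simplex) q1" "\<forall>p\<in>prob_simplex. R1 p - R1 q1 \<le> D1\<^sup>2"
    and "is_arg_min R2 (\<lambda>q. q \<in> prob_simplex) q2" "\<forall>p\<in>prob_simplex. R2 p - R2 q2 \<le> D2\<^sup>2"
    and "\<exists>\<eta>>0. omd_regret_bound \<Omega>1 R1 g1 \<eta> T L1 (D1 * sqrt (2 * real T / \<alpha>1))"
    and "\<exists>\<eta>>0. omd_regret_bound \<Omega>2 R2 g2 \<eta> T L2 (D2 * sqrt (2 * real T / \<alpha>2))"
    and "has_gradient_on (\<lambda>x. R1 x + R2 x) g (\<Omega>1 \<inter> \<Omega>2)"
  shows "omd_regret_bound (\<Omega>1 \<inter> \<Omega>2) (\<lambda>x. R1 x + R2 x) g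
           (sqrt ((D1\<^sup>2 + D2\<^sup>2) * min \<alpha>1 \<alpha>2 / real T)) T
           {l1 + l2 | l1 l2. l1 \<in> L1 \<and> l2 \<in> L2}
           (2 * sqrt ((D1\<^sup>2 + D2\<^sup>2) * real T / min \<alpha>1 \<alpha>2))"
proof -
  define R where "R = (\<lambda>x. R1 x + R2 x)"
  define D where "D = D1\<^sup>2 + D2\<^sup>2"
  define \<alpha> where "\<alpha> = min \<alpha>1 \<alpha>2"
  define \<eta> where "\<eta> = sqrt (D * \<alpha> / real T)"
  have \<alpha>: "0 < \<alpha>" "\<alpha> \<le> \<alpha>1" "\<alpha> \<le> \<alpha>2"
    using \<open>0 < \<alpha>1\<close> \<open>0 < \<alpha>2\<close> by (auto simp: \<alpha>_def)
  have T: "0 < real T" using \<open>1 \<le> T\<close> by simp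
  have D: "0 \<le> D" by (simp add: D_def)
  have \<eta>: "0 \<le> \<eta>" "\<eta>\<^sup>2 = D * \<alpha> / real T"
    using D \<alpha> by (auto simp: \<eta>_def)
  have grad: "has_gradient_on R g prob_simplex"
    unfolding R_def using assms(13,15) by (intro has_gradient_on_subset[OF assms(30)]) auto
  have grad12: "has_gradient_on R (\<lambda>x. g1 x + g2 x) prob_simplex"
    unfolding R_def
    by (intro has_gradient_on_add has_gradient_on_subset[OF assms(17) assms(13)]
        has_gradient_on_subset[OF assms(19) assms(15)])
  \<comment> \<open>The given \<open>g\<close> need not equal \<open>g1 + g2\<close>, but the two
    agree along directions between points of the simplex, and the divergence sees nothing else
    there.\<close>
  have breg: "bregman R g y x = bregman R1 g1 y x + bregman R2 g2 y x"
    if "x \<in> prob_simplex" "y \<in> prob_simplex" for x y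
    using gradient_inner_unique[OF convex_prob_simplex that grad grad12]
    by (simp add: bregman_def R_def inner_commute[of "y - x"] inner_add_left)
  \<comment> \<open>\<open>p 1\<close> minimises the sum and not each regularizer, so each one is
    bounded between arbitrary points of the simplex.\<close>
  have range1: "R1 x - R1 y \<le> D1\<^sup>2" and range2: "R2 x - R2 y \<le> D2\<^sup>2"
    if "x \<in> prob_simplex" "y \<in> prob_simplex" for x y
  proof -
    have "R1 q1 \<le> R1 y" "R2 q2 \<le> R2 y"
      using that assms(24,26) by (auto simp: is_arg_min_def not_less)
    moreover have "R1 x - R1 q1 \<le> D1\<^sup>2" "R2 x - R2 q2 \<le> D2\<^sup>2"
      using that assms(25,27) by auto
    ultimately show "R1 x - R1 y \<le> D1\<^sup>2" "R2 x - R2 y \<le> D2\<^sup>2" by linarith+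
  qed
  have "regret T l p \<le> 2 * sqrt (D * real T / \<alpha>)"
    if l: "\<forall>t\<in>{1..T}. l t \<in> {l1 + l2 | l1 l2. l1 \<in> L1 \<and> l2 \<in> L2}"
      and run: "omd_run (\<Omega>1 \<inter> \<Omega>2) R g \<eta> T l p" for l p
  proof (rule regret_le_if_inner_sum_le)
    fix q :: "real ^ 'n" assume q: "q \<in> prob_simplex"
    have p1: "p 1 \<in> prob_simplex" using run by (simp add: omd_run_def is_arg_min_def)
    \<comment> \<open>Each summand of the loss is charged to its own divergence; the two constants
      are at most \<open>\<eta>\<^sup>2 / (2 * \<alpha>)\<close> each.\<close>
    have step: "\<eta> * (l t \<bullet> (x - y)) \<le> bregman R g y x + \<eta>\<^sup>2 / \<alpha>"
      if t: "t \<in> {1..T}" and xy: "x \<in> prob_simplex" "y \<in> prob_simplex" for t x y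
    proof -
      obtain l1 l2 where l12: "l t = l1 + l2" "l1 \<in> L1" "l2 \<in> L2"
        using l t by blast
      have "\<eta> * (l1 \<bullet> (x - y)) \<le> bregman R1 g1 y x + \<eta>\<^sup>2 / (2 * \<alpha>1)"
        using l12 assms by (intro strongly_convex_on_inner_le[OF _ _ _ _ _ xy \<eta>(1)]) auto
      moreover have "\<eta> * (l2 \<bullet> (x - y)) \<le> bregman R2 g2 y x + \<eta>\<^sup>2 / (2 * \<alpha>2)"
        using l12 assms by (intro strongly_convex_on_inner_le[OF _ _ _ _ _ xy \<eta>(1)]) auto
      moreover have "\<eta>\<^sup>2 / (2 * \<alpha>1) \<le> \<eta>\<^sup>2 / (2 * \<alpha>)" "\<eta>\<^sup>2 / (2 * \<alpha>2) \<le> \<eta>\<^sup>2 / (2 * \<alpha>)"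
        using \<alpha> by (auto intro!: divide_left_mono)
      moreover have "\<eta>\<^sup>2 / \<alpha> = \<eta>\<^sup>2 / (2 * \<alpha>) + \<eta>\<^sup>2 / (2 * \<alpha>)"
        by simp
      ultimately show ?thesis
        by (simp add: l12 breg[OF xy] inner_add_left distrib_left)
    qed
    have main: "\<eta> * (\<Sum>t=1..T. l t \<bullet> (p t - q)) \<le> R q - R (p 1) + real T * (\<eta>\<^sup>2 / \<alpha>)"
      by (rule omd_run_inner_sum_le[OF \<open>1 \<le> T\<close> grad run q step])
    show "(\<Sum>t=1..T. l t \<bullet> (p t - q)) \<le> 2 * sqrt (D * real T / \<alpha>)"
    proof (cases "D = 0")
      case True
      \<comment> \<open>Then \<open>\<eta> = 0\<close> and the bound above is void, but the simplex is a single point.\<close>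
      then have "D1\<^sup>2 = 0" by (simp add: D_def add_nonneg_eq_0_iff)
      then have const: "R1 z = R1 q" if "z \<in> prob_simplex" for z
        using range1[OF that q] range1[OF q that] by simp
      have eq: "x = q" if "x \<in> prob_simplex" for x
        by (rule strictly_convex_on_constant_imp_eq[OF assms(16) assms(13) convex_prob_simplex
              const that q])
      have "p t = q" if "t \<in> {1..T}" for t
      proof (cases "t = 1")
        case False
        then have "t - 1 \<in> {1..<T}" "Suc (t - 1) = t" using that by auto
        then have "p t \<in> prob_simplex"
          using run[unfolded omd_run_def, THEN conjunct2, rule_format, of "t - 1"]
          by (auto simp: is_arg_min_def)
        then show ?thesis by (rule eq)
      qed (use p1 eq in simp)
      then show ?thesis using True by simp
    next
      case False
      then have pos: "0 < \<eta>" using D \<alpha> T by (simp add: \<eta>_def)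
      have "R q - R (p 1) \<le> D"
        using range1[OF q p1] range2[OF q p1] by (simp add: R_def D_def)
      \<comment> \<open>The choice of \<open>\<eta>\<close> balances the two terms: the range of
        \<open>R\<close> is at most \<open>D\<close>, and the accumulated cost is exactly
        \<open>D\<close>. Dividing their total \<open>2 * D\<close> by \<open>\<eta>\<close> gives
        the claimed bound.\<close>
      moreover have "real T * (\<eta>\<^sup>2 / \<alpha>) = D"
        using T \<alpha> by (simp add: \<eta>)
      moreover have "\<eta> * sqrt (D * real T / \<alpha>) = D"
      proof -
        have "(D * \<alpha> / real T) * (D * real T / \<alpha>) = D\<^sup>2"
          using T \<alpha> by (simp add: power2_eq_square)
        then show ?thesis
          using D by (simp add: \<eta>_def flip: real_sqrt_mult)
      qed
      ultimately have "\<eta> * (\<Sum>t=1..T. l t \<bullet> (p t - q)) \<le> \<eta> * (2 * sqrt (D * real T / \<alpha>))"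
        using main by (simp only: mult.left_commute[of \<eta> 2])
      then show ?thesis using pos by simp
    qed
  qed
  then show ?thesis
    unfolding omd_regret_bound_def \<eta>_def R_def D_def \<alpha>_def by blast
qed

end
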